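(* Let $\{X_t: t\ge0\}$ be an irreducible continuous-time Markov process on a countable state space $E$ which admits a stationary measure $\mu$, with generator $L$. If $L$ satisfies a sector condition and if the Markov process $\{X^s_t:t\ge0\}$ is recurrent, then $\{X_t:t\ge 0\}$ is recurrent.
   Context: $X_t$ has jump rates $r(x,y)$ ($x\ne y$) and holding rates $\lambda(x)=\sum_y r(x,y)$, with paths in the space of right-continuous functions with left limits $D(\mathbb R_+,E)$. The stationary measure $\mu$ (not necessarily finite, $\mu(x)>0$) satisfies $\sum_y\mu(y)r(y,x)=\mu(x)\lambda(x)$. $(Lf)(x)=\sum_y r(x,y)[f(y)-f(x)]$, and $L$ is regarded as an operator on a domain in $L^2(\mu)$, which contains the finitely supported functions; $\langle f,g\rangle_\mu=\sum_x\mu(x)f(x)g(x)$. Sector condition: there is a constant $C_0$ such that for all $f,g$ in the domain of $L$, $$\langle Lf,g\rangle_\mu^2\le C_0\,\langle(-L)f,f\rangle_\mu\,\langle(-L)g,g\rangle_\mu .$$ The adjoint rates $r^*(x,y)$ are defined by $\mu(x)r(x,y)=\mu(y)r^*(y,x)$. $X^s_t$, the symmetric (reversible) version of $X_t$, is the Markov process with jump rates $\frac12\{r(x,y)+r^*(x,y)\}$, i.e. with generator $S=\frac12(L+L^* )$, where $L^*$ is the generator of the adjoint process. *)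

theory Defs
  imports "HOL-Probability.Probability"
begin

text \<open>The state space is a countable type. Rates are functions of two states; since only
  \<open>r x y\<close> with \<open>x \<noteq> y\<close> is meaningful, the diagonal is set to zero.\<close>

definition jump_rates :: "('a::countable \<Rightarrow> 'a \<Rightarrow> real) \<Rightarrow> bool" where
  "jump_rates r \<longleftrightarrow>
     (\<forall>x y. 0 \<le> r x y) \<and> (\<forall>x. r x x = 0) \<and> (\<forall>x. r x summable_on UNIV)"

definition holding_rate :: "('a::countable \<Rightarrow> 'a \<Rightarrow> real) \<Rightarrow> 'a \<Rightarrow> real" where
  "holding_rate r x = (\<Sum>\<^sub>\<infinity>y. r x y)"

text \<open>The measure need not be finite.\<close>

definition stationary_measure :: "('a::countable \<Rightarrow> 'a \<Rightarrow> real) \<Rightarrow> ('a \<Rightarrow> real) \<Rightarrow> bool" where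
  "stationary_measure r \<mu> \<longleftrightarrow>
     (\<forall>x. 0 < \<mu> x) \<and> (\<forall>x. ((\<lambda>y. \<mu> y * r y x) has_sum (\<mu> x * holding_rate r x)) UNIV)"

definition adjoint_rate :: "('a \<Rightarrow> real) \<Rightarrow> ('a \<Rightarrow> 'a \<Rightarrow> real) \<Rightarrow> 'a \<Rightarrow> 'a \<Rightarrow> real" where
  "adjoint_rate \<mu> r x y = \<mu> y * r y x / \<mu> x"

lemma adjoint_rate_balance:
  assumes "\<And>x. 0 < \<mu> x"
  shows "\<mu> x * r x y = \<mu> y * adjoint_rate \<mu> r y x"
  using assms[of y] by (simp add: adjoint_rate_def)

definition symmetric_rate :: "('a \<Rightarrow> real) \<Rightarrow> ('a \<Rightarrow> 'a \<Rightarrow> real) \<Rightarrow> 'a \<Rightarrow> 'a \<Rightarrow> real" where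
  "symmetric_rate \<mu> r x y = (r x y + adjoint_rate \<mu> r x y) / 2"

definition L2 :: "('a::countable \<Rightarrow> real) \<Rightarrow> ('a \<Rightarrow> real) set" where
  "L2 \<mu> = {f. (\<lambda>x. \<mu> x * (f x)\<^sup>2) summable_on UNIV}"

definition inner_L2 :: "('a::countable \<Rightarrow> real) \<Rightarrow> ('a \<Rightarrow> real) \<Rightarrow> ('a \<Rightarrow> real) \<Rightarrow> real" where
  "inner_L2 \<mu> f g = (\<Sum>\<^sub>\<infinity>x. \<mu> x * f x * g x)"

definition generator :: "('a::countable \<Rightarrow> 'a \<Rightarrow> real) \<Rightarrow> ('a \<Rightarrow> real) \<Rightarrow> 'a \<Rightarrow> real" where
  "generator r f x = (\<Sum>\<^sub>\<infinity>y. r x y * (f y - f x))"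

text \<open>\<open>D\<close> is a linear subspace of \<open>L2 \<mu>\<close> containing the finitely supported functions, on which
  the series defining the generator converges and takes values in \<open>L2 \<mu>\<close>.\<close>

definition generator_domain ::
    "('a::countable \<Rightarrow> 'a \<Rightarrow> real) \<Rightarrow> ('a \<Rightarrow> real) \<Rightarrow> ('a \<Rightarrow> real) set \<Rightarrow> bool" where
  "generator_domain r \<mu> D \<longleftrightarrow>
     D \<subseteq> L2 \<mu> \<and>
     (\<forall>f\<in>D. \<forall>g\<in>D. \<forall>a b. (\<lambda>x. a * f x + b * g x) \<in> D) \<and>
     (\<forall>f. finite {x. f x \<noteq> 0} \<longrightarrow> f \<in> D) \<and>
     (\<forall>f\<in>D. (\<forall>x. (\<lambda>y. r x y * (f y - f x)) summable_on UNIV) \<and> generator r f \<in> L2 \<mu>)"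

definition sector_condition ::
    "('a::countable \<Rightarrow> 'a \<Rightarrow> real) \<Rightarrow> ('a \<Rightarrow> real) \<Rightarrow> ('a \<Rightarrow> real) set \<Rightarrow> bool" where
  "sector_condition r \<mu> D \<longleftrightarrow>
     (\<exists>C0. \<forall>f\<in>D. \<forall>g\<in>D.
        (inner_L2 \<mu> (generator r f) g)\<^sup>2
          \<le> C0 * inner_L2 \<mu> (\<lambda>x. - generator r f x) f * inner_L2 \<mu> (\<lambda>x. - generator r g x) g)"

text \<open>Right-continuity and existence of left limits on \<open>[0, \<infinity>)\<close> for the discrete topology on the
  state space, in which convergence means being eventually constant.\<close>

definition cadlag_path :: "(real \<Rightarrow> 'a) \<Rightarrow> bool" where
  "cadlag_path w \<longleftrightarrow>
     (\<forall>t\<ge>0. eventually (\<lambda>s. w s = w t) (at_right t)) \<and>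
     (\<forall>t>0. \<exists>y. eventually (\<lambda>s. w s = y) (at_left t))"

text \<open>The time of the \<open>n\<close>-th jump; it is \<open>\<infinity>\<close> if the path jumps fewer than \<open>n\<close> times.\<close>

primrec jump_time :: "(real \<Rightarrow> 'a) \<Rightarrow> nat \<Rightarrow> ereal" where
  "jump_time w 0 = 0"
| "jump_time w (Suc n) =
     Inf {ereal t | t. jump_time w n < ereal t \<and> w t \<noteq> w (real_of_ereal (jump_time w n))}"

text \<open>\<open>jump_chain w n\<close> is only meaningful if \<open>jump_time w n < \<infinity>\<close>.\<close>

definition jump_chain :: "(real \<Rightarrow> 'a) \<Rightarrow> nat \<Rightarrow> 'a" where
  "jump_chain w n = w (real_of_ereal (jump_time w n))"

definition holding_time :: "(real \<Rightarrow> 'a) \<Rightarrow> nat \<Rightarrow> ereal" where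
  "holding_time w n = jump_time w (Suc n) - jump_time w n"

text \<open>The Markov process with jump rates \<open>r\<close>, in the standard jump chain and holding time
  formulation: under \<open>P x\<close> the process starts at \<open>x\<close>, the successively visited states form a Markov
  chain with transition probabilities \<open>r y z / holding_rate r y\<close>, and, given these states, the
  holding times are independent exponential variables with parameters \<open>holding_rate r y\<close>.
  If \<open>holding_rate r y = 0\<close> the quotient is \<open>0\<close>, so that almost surely no jump out of \<open>y\<close> occurs.
  Since the paths are cadlag on the whole of \<open>[0, \<infinity>)\<close>, there is no explosion.\<close>

definition markov_jump_process ::
    "('a::countable \<Rightarrow> 'a \<Rightarrow> real) \<Rightarrow> ('a \<Rightarrow> 'w measure) \<Rightarrow> (real \<Rightarrow> 'w \<Rightarrow> 'a) \<Rightarrow> bool" where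
  "markov_jump_process r P X \<longleftrightarrow>
     (\<forall>x. prob_space (P x) \<and>
          (\<forall>t\<ge>0. X t \<in> measurable (P x) (count_space UNIV)) \<and>
          (\<forall>\<omega>\<in>space (P x). X 0 \<omega> = x \<and> cadlag_path (\<lambda>t. X t \<omega>)) \<and>
          (\<forall>n (y::nat \<Rightarrow> 'a) (s::nat \<Rightarrow> real). y 0 = x \<longrightarrow> (\<forall>i<n. 0 \<le> s i) \<longrightarrow>
             measure (P x) {\<omega> \<in> space (P x).
                 jump_time (\<lambda>t. X t \<omega>) n < \<infinity> \<and>
                 (\<forall>i\<le>n. jump_chain (\<lambda>t. X t \<omega>) i = y i) \<and>
                 (\<forall>i<n. ereal (s i) < holding_time (\<lambda>t. X t \<omega>) i)}
             = (\<Prod>i<n. r (y i) (y (Suc i)) / holding_rate r (y i)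
                          * exp (- holding_rate r (y i) * s i))))"

definition irreducible_process ::
    "('a \<Rightarrow> 'w measure) \<Rightarrow> (real \<Rightarrow> 'w \<Rightarrow> 'a) \<Rightarrow> bool" where
  "irreducible_process P X \<longleftrightarrow>
     (\<forall>x y. \<exists>t\<ge>0. 0 < measure (P x) {\<omega> \<in> space (P x). X t \<omega> = y})"

definition recurrent_process ::
    "('a \<Rightarrow> 'w measure) \<Rightarrow> (real \<Rightarrow> 'w \<Rightarrow> 'a) \<Rightarrow> bool" where
  "recurrent_process P X \<longleftrightarrow>
     (\<forall>x. AE \<omega> in P x. \<not> bdd_above {t. 0 \<le> t \<and> X t \<omega> = x})"

end

theory Submission
  imports Defs
begin

text \<open>For a state \<open>c\<close> in a finite set \<open>F\<close>, let \<open>h\<close> and \<open>g\<close> be the probabilities of hitting \<open>c\<close>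
  before leaving \<open>F\<close>, for \<open>X\<close> and for its symmetric version. Since \<open>h\<close> is \<open>L\<close>-harmonic on
  \<open>F - {c}\<close> and \<open>g - h\<close> vanishes at \<open>c\<close> and off \<open>F\<close>, we have
  \<open>\<langle>-L h, h\<rangle> = \<langle>-L h, g\<rangle>\<close>, so the sector condition yields
  \<open>\<langle>-L h, h\<rangle> \<le> C0 \<langle>-L g, g\<rangle> = C0 \<langle>-S g, g\<rangle>\<close>. Both outer terms are the common factor
  \<open>\<mu> c * holding_rate r c\<close> times the probability of escaping from \<open>F\<close> before returning to \<open>c\<close>.
  As \<open>F\<close> exhausts the state space, recurrence of the symmetric process sends the right-hand side
  to 0, and hence \<open>X\<close> returns to \<open>c\<close> almost surely.\<close>

section \<open>Jump times of cadlag paths\<close>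

lemma jump_time_nonneg: "0 \<le> jump_time w n"
proof (induction n)
  case (Suc n)
  show ?case
    unfolding jump_time.simps
    by (rule Inf_greatest) (use Suc in \<open>auto intro: less_imp_le le_less_trans\<close>)
qed simp

lemma jump_time_mono_Suc: "jump_time w n \<le> jump_time w (Suc n)"
  by (auto intro: Inf_greatest)

lemma jump_time_mono: "m \<le> n \<Longrightarrow> jump_time w m \<le> jump_time w n"
  by (rule lift_Suc_mono_le[of "jump_time w", OF jump_time_mono_Suc])

lemma jump_time_finite_mono: "m \<le> n \<Longrightarrow> jump_time w n < \<infinity> \<Longrightarrow> jump_time w m < \<infinity>"
  using jump_time_mono le_less_trans by blast

lemma jump_time_real: "jump_time w n < \<infinity> \<Longrightarrow> ereal (real_of_ereal (jump_time w n)) = jump_time w n"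
  using jump_time_nonneg[of w n] by (cases "jump_time w n") auto

lemma path_eq_jump_chain:
  assumes "jump_time w n \<le> ereal t" "ereal t < jump_time w (Suc n)"
  shows "w t = jump_chain w n"
proof (rule ccontr)
  assume *: "w t \<noteq> jump_chain w n"
  then have "jump_time w n \<noteq> ereal t" by (auto simp: jump_chain_def)
  with assms have "jump_time w n < ereal t" by simp
  with * have "jump_time w (Suc n) \<le> ereal t"
    by (auto simp: jump_chain_def intro!: Inf_lower)
  with assms show False by simp
qed

lemma cadlag_path_rightD:
  assumes "cadlag_path w" "0 \<le> t"
  obtains u where "t < u" "\<And>s. t \<le> s \<Longrightarrow> s < u \<Longrightarrow> w s = w t"
proof -
  from assms have "eventually (\<lambda>s. w s = w t) (at_right t)" by (auto simp: cadlag_path_def)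
  then obtain u where "t < u" "\<forall>s>t. s < u \<longrightarrow> w s = w t"
    by (auto simp: eventually_at_right_field)
  then show ?thesis by (intro that[of u]) (auto simp: le_less)
qed

text \<open>Right-continuity keeps the path constant on some \<open>[\<tau>, u)\<close>, so
  \<open>u\<close> is a lower bound of the set whose infimum is the next jump time.\<close>

lemma jump_time_less_Suc:
  assumes "cadlag_path w" "jump_time w n < \<infinity>"
  shows "jump_time w n < jump_time w (Suc n)"
proof -
  define \<tau> where "\<tau> = real_of_ereal (jump_time w n)"
  have \<tau>: "jump_time w n = ereal \<tau>" "0 \<le> \<tau>"
    using jump_time_real[OF assms(2)] jump_time_nonneg[of w n]
    by (auto simp: \<tau>_def real_of_ereal_pos)
  obtain u where u: "\<tau> < u" "\<And>s. \<tau> \<le> s \<Longrightarrow> s < u \<Longrightarrow> w s = w \<tau>"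
    using cadlag_path_rightD[OF assms(1) \<tau>(2)] by blast
  have "ereal u \<le> jump_time w (Suc n)"
    unfolding jump_time.simps
  proof (rule Inf_greatest, clarify)
    fix t assume "jump_time w n < ereal t" "w t \<noteq> w (real_of_ereal (jump_time w n))"
    then show "ereal u \<le> ereal t"
      using u(2)[of t] by (force simp: \<tau>)
  qed
  with u(1) \<tau>(1) show ?thesis
    by (simp only: less_le_trans[of "ereal \<tau>" "ereal u"] less_ereal.simps)
qed

text \<open>The infimum defining a jump time is attained: were the old value still taken there,
  right-continuity would prolong it up to some later \<open>u\<close>, and the infimum would be at
  least \<open>u\<close>.\<close>

lemma jump_chain_Suc_neq:
  assumes "cadlag_path w" "jump_time w (Suc n) < \<infinity>"
  shows "jump_chain w (Suc n) \<noteq> jump_chain w n"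
proof
  assume eq: "jump_chain w (Suc n) = jump_chain w n"
  define \<tau> where "\<tau> = real_of_ereal (jump_time w (Suc n))"
  have \<tau>: "jump_time w (Suc n) = ereal \<tau>" "0 \<le> \<tau>"
    using jump_time_real[OF assms(2)] jump_time_nonneg[of w "Suc n"]
    by (auto simp: \<tau>_def real_of_ereal_pos)
  obtain u where u: "\<tau> < u" "\<And>s. \<tau> \<le> s \<Longrightarrow> s < u \<Longrightarrow> w s = w \<tau>"
    using cadlag_path_rightD[OF assms(1) \<tau>(2)] by blast
  have "ereal u \<le> jump_time w (Suc n)"
    unfolding jump_time.simps
  proof (rule Inf_greatest, clarify)
    fix t assume t: "jump_time w n < ereal t" "w t \<noteq> w (real_of_ereal (jump_time w n))"
    then have "ereal \<tau> \<le> ereal t"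
      unfolding \<tau>(1)[symmetric] by (auto intro!: Inf_lower)
    then show "ereal u \<le> ereal t"
      using u(2)[of t] t(2) eq by (force simp: jump_chain_def \<tau>_def)
  qed
  with u(1) \<tau>(1) show False by simp
qed

text \<open>An accumulation point of the jump times would be a time without a left limit.\<close>

lemma jump_time_unbounded:
  assumes "cadlag_path w"
  shows "\<exists>n. ereal t < jump_time w n"
proof (rule ccontr)
  assume "\<not> ?thesis"
  then have le: "jump_time w n \<le> ereal t" for n by (meson not_less)
  then have fin: "jump_time w n < \<infinity>" for n
    using le_less_trans[OF le[of n], of \<infinity>] by simp
  define \<tau> where "\<tau> n = real_of_ereal (jump_time w n)" for n
  have \<tau>: "jump_time w n = ereal (\<tau> n)" for n
    using jump_time_real[OF fin] by (simp add: \<tau>_def)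
  have less: "\<tau> n < \<tau> (Suc n)" for n
    using jump_time_less_Suc[OF assms fin, of n] unfolding \<tau> by simp
  define l where "l = (SUP n. \<tau> n)"
  have bdd: "bdd_above (range \<tau>)"
    using le by (auto simp: \<tau> intro!: bdd_aboveI[of _ t])
  have lt: "\<tau> n < l" for n
    using less[of n] cSUP_upper[OF _ bdd, of "Suc n"] by (simp add: l_def)
  have "0 < l" using lt[of 0] jump_time.simps(1)[of w] unfolding \<tau> by simp
  with assms obtain y where "eventually (\<lambda>s. w s = y) (at_left l)"
    by (auto simp: cadlag_path_def)
  then obtain b where b: "b < l" "\<And>s. b < s \<Longrightarrow> s < l \<Longrightarrow> w s = y"
    by (auto simp: eventually_at_left_field)
  obtain n where "b < \<tau> n"
    using b(1) less_cSUP_iff[OF _ bdd, of b] by (auto simp: l_def)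
  then have "w (\<tau> n) = y" "w (\<tau> (Suc n)) = y"
    using b(2) lt less[of n] by (auto intro: less_trans)
  then show False
    using jump_chain_Suc_neq[OF assms fin, of n] by (simp add: jump_chain_def \<tau>_def)
qed

text \<open>As the jump times exceed every bound, the intervals between consecutive ones cover all
  nonnegative times.\<close>

lemma path_in_jump_chain:
  assumes "cadlag_path w" "0 \<le> t"
  obtains n where "jump_time w n \<le> ereal t" "ereal t < jump_time w (Suc n)" "w t = jump_chain w n"
proof -
  define m where "m = (LEAST n. ereal t < jump_time w n)"
  have m: "ereal t < jump_time w m"
    unfolding m_def using jump_time_unbounded[OF assms(1)] by (rule LeastI_ex)
  with assms(2) obtain n where n: "m = Suc n" by (cases m) auto
  then have "jump_time w n \<le> ereal t"
    using not_less_Least[of n "\<lambda>n. ereal t < jump_time w n"] by (auto simp: m_def)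
  with m n that path_eq_jump_chain show ?thesis by metis
qed

text \<open>Visits at arbitrarily large indices occur at arbitrarily large times, because the jump
  times exceed every bound.\<close>

lemma recurrent_pathI:
  assumes "cadlag_path w" "\<And>n. jump_time w n < \<infinity>" "\<And>n. \<exists>i>n. jump_chain w i = x"
  shows "\<not> bdd_above {t. 0 \<le> t \<and> w t = x}"
proof
  assume "bdd_above {t. 0 \<le> t \<and> w t = x}"
  then obtain b where b: "\<And>t. 0 \<le> t \<Longrightarrow> w t = x \<Longrightarrow> t \<le> b" by (auto simp: bdd_above_def)
  obtain n where n: "ereal b < jump_time w n" using jump_time_unbounded[OF assms(1)] by blast
  obtain i where i: "i > n" "jump_chain w i = x" using assms(3) by blast
  have "real_of_ereal (jump_time w i) \<le> b"
    using i(2) by (intro b) (auto simp: jump_chain_def real_of_ereal_pos jump_time_nonneg)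
  then have "jump_time w i \<le> ereal b"
    by (metis assms(2) ereal_less_eq(3) jump_time_real)
  moreover have "jump_time w n \<le> jump_time w i" using i(1) by (intro jump_time_mono) simp
  ultimately show False using n by simp
qed

text \<open>Every visit to \<open>x\<close> then falls before the first jump, which happens at a
  finite time.\<close>

lemma transient_pathI:
  assumes "cadlag_path w" "jump_time w 1 < \<infinity>" "\<And>n. 0 < n \<Longrightarrow> jump_chain w n \<noteq> x"
  shows "bdd_above {t. 0 \<le> t \<and> w t = x}"
proof (rule bdd_aboveI, clarify)
  fix t :: real assume "0 \<le> t" "x = w t"
  then obtain n where n: "ereal t < jump_time w (Suc n)" "x = jump_chain w n"
    using path_in_jump_chain[OF assms(1)] by metis
  with assms(3) have "n = 0" by auto
  with n have "ereal t < jump_time w 1" by simp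
  then show "t \<le> real_of_ereal (jump_time w 1)"
    using jump_time_real[OF assms(2)] by (metis ereal_less_eq(3) less_imp_le)
qed

section \<open>Measurability of the jump times and the jump chain\<close>

text \<open>The random time is approximated from the right by times with countably many values;
  right-continuity in the discrete topology makes the approximating states eventually equal to the
  limit.\<close>

lemma measurable_at_random_time:
  fixes X :: "real \<Rightarrow> 'w \<Rightarrow> 'a::countable"
  assumes X: "\<And>t. 0 \<le> t \<Longrightarrow> X t \<in> measurable M (count_space UNIV)"
    and cadlag: "\<And>\<omega>. \<omega> \<in> space M \<Longrightarrow> cadlag_path (\<lambda>t. X t \<omega>)"
    and \<tau>[measurable]: "\<tau> \<in> borel_measurable M" and \<tau>0: "\<And>\<omega>. \<omega> \<in> space M \<Longrightarrow> 0 \<le> \<tau> \<omega>"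
  shows "(\<lambda>\<omega>. X (\<tau> \<omega>) \<omega>) \<in> measurable M (count_space UNIV)"
proof -
  \<comment> \<open>\<open>\<sigma> k\<close> is a grid point of mesh \<open>1 / Suc k\<close> to
    the right of \<open>\<tau>\<close>; the added 1 keeps it from falling to the left, where
    right-continuity gives nothing.\<close>
  define \<sigma> where "\<sigma> k \<omega> = (real (nat \<lfloor>\<tau> \<omega> * Suc k\<rfloor>) + 1) / Suc k" for k \<omega>
  have [measurable]: "(\<lambda>\<omega>. X (\<sigma> k \<omega>) \<omega>) \<in> measurable M (count_space UNIV)" for k
    unfolding \<sigma>_def
    by (rule measurable_compose_countable[where f="\<lambda>i. X ((real i + 1) / Suc k)"
          and g="\<lambda>\<omega>. nat \<lfloor>\<tau> \<omega> * Suc k\<rfloor>"]) (auto intro!: X)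
  have ev: "\<exists>N. \<forall>k\<ge>N. X (\<sigma> k \<omega>) \<omega> = X (\<tau> \<omega>) \<omega>" if \<omega>: "\<omega> \<in> space M" for \<omega>
  proof -
    obtain u where u: "\<tau> \<omega> < u" "\<And>s. \<tau> \<omega> \<le> s \<Longrightarrow> s < u \<Longrightarrow> X s \<omega> = X (\<tau> \<omega>) \<omega>"
      using cadlag_path_rightD[OF cadlag[OF \<omega>] \<tau>0[OF \<omega>]] by blast
    have bnd: "\<tau> \<omega> \<le> \<sigma> k \<omega> \<and> \<sigma> k \<omega> \<le> \<tau> \<omega> + 1 / Suc k" for k
    proof -
      have "0 \<le> \<tau> \<omega> * Suc k" using \<tau>0[OF \<omega>] by simp
      then have "real (nat \<lfloor>\<tau> \<omega> * Suc k\<rfloor>) = of_int \<lfloor>\<tau> \<omega> * Suc k\<rfloor>" by simp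
      then have "\<tau> \<omega> * Suc k \<le> real (nat \<lfloor>\<tau> \<omega> * Suc k\<rfloor>) + 1"
        "real (nat \<lfloor>\<tau> \<omega> * Suc k\<rfloor>) \<le> \<tau> \<omega> * Suc k" by linarith+
      moreover have bound: "x \<le> (m + 1) / K \<and> (m + 1) / K \<le> x + 1 / K"
        if "0 < K" "x * K \<le> m + 1" "m \<le> x * K" for x m K :: real
        using that by (simp add: field_simps)
      ultimately show ?thesis
        unfolding \<sigma>_def by (intro bound) (simp_all only: of_nat_0_less_iff zero_less_Suc)
    qed
    obtain N where N: "inverse (Suc N) < u - \<tau> \<omega>"
      using reals_Archimedean[of "u - \<tau> \<omega>"] u(1) by auto
    show ?thesis
    proof (intro exI[of _ N] allI impI)
      fix k assume "N \<le> k"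
      then have "1 / Suc k \<le> inverse (Suc N)" by (simp add: field_simps)
      with N bnd[of k] show "X (\<sigma> k \<omega>) \<omega> = X (\<tau> \<omega>) \<omega>"
        by (intro u(2)) linarith+
    qed
  qed
  \<comment> \<open>Eventual constancy turns the event into a countable union of countable
    intersections.\<close>
  have "{\<omega>\<in>space M. X (\<tau> \<omega>) \<omega> = y} = {\<omega>\<in>space M. \<exists>N. \<forall>k\<ge>N. X (\<sigma> k \<omega>) \<omega> = y}" for y
  proof (intro Collect_cong conj_cong refl iffI)
    fix \<omega> assume \<omega>: "\<omega> \<in> space M"
    then obtain N where N: "\<forall>k\<ge>N. X (\<sigma> k \<omega>) \<omega> = X (\<tau> \<omega>) \<omega>" using ev by blast
    then show "\<exists>N. \<forall>k\<ge>N. X (\<sigma> k \<omega>) \<omega> = y" if "X (\<tau> \<omega>) \<omega> = y" using that by blast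
    show "X (\<tau> \<omega>) \<omega> = y" if "\<exists>N. \<forall>k\<ge>N. X (\<sigma> k \<omega>) \<omega> = y"
    proof -
      from that obtain N' where "\<forall>k\<ge>N'. X (\<sigma> k \<omega>) \<omega> = y" by blast
      then have "X (\<sigma> (max N N') \<omega>) \<omega> = y" by simp
      moreover have "X (\<sigma> (max N N') \<omega>) \<omega> = X (\<tau> \<omega>) \<omega>" using N by simp
      ultimately show ?thesis by simp
    qed
  qed
  moreover have "{\<omega>\<in>space M. \<exists>N. \<forall>k\<ge>N. X (\<sigma> k \<omega>) \<omega> = y} \<in> sets M" for y by measurable
  ultimately show ?thesis
    by (simp add: measurable_count_space_eq2_countable vimage_def Int_def conj_commute)
qed

text \<open>Induction along the path: a measurable jump time gives a measurable state there, and the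
  next jump time is an infimum over rational times.\<close>

lemma measurable_jump:
  fixes X :: "real \<Rightarrow> 'w \<Rightarrow> 'a::countable"
  assumes X: "\<And>t. 0 \<le> t \<Longrightarrow> X t \<in> measurable M (count_space UNIV)"
    and cadlag: "\<And>\<omega>. \<omega> \<in> space M \<Longrightarrow> cadlag_path (\<lambda>t. X t \<omega>)"
  shows "(\<lambda>\<omega>. jump_time (\<lambda>t. X t \<omega>) n) \<in> borel_measurable M"
    and "(\<lambda>\<omega>. jump_chain (\<lambda>t. X t \<omega>) n) \<in> measurable M (count_space UNIV)"
proof -
  \<comment> \<open>At an infinite jump time \<open>real_of_ereal\<close> returns 0, so the state is
    read off at a nonnegative time in every case.\<close>
  have chain: "(\<lambda>\<omega>. jump_chain (\<lambda>t. X t \<omega>) n) \<in> measurable M (count_space UNIV)"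
    if [measurable]: "(\<lambda>\<omega>. jump_time (\<lambda>t. X t \<omega>) n) \<in> borel_measurable M" for n
    unfolding jump_chain_def
    by (rule measurable_at_random_time[OF X cadlag])
      (auto simp: real_of_ereal_pos jump_time_nonneg)
  show time: "(\<lambda>\<omega>. jump_time (\<lambda>t. X t \<omega>) n) \<in> borel_measurable M" for n
  proof (induction n)
    case (Suc n)
    note [measurable] = Suc chain[OF Suc]
    define Q where "Q = \<rat> \<inter> {0::real..}"
    \<comment> \<open>The value \<infinity> at times that do not qualify lets the infimum range over
      a fixed countable set.\<close>
    define J where "J \<omega> q = (if jump_time (\<lambda>t. X t \<omega>) n < ereal q \<and>
      X q \<omega> \<noteq> jump_chain (\<lambda>t. X t \<omega>) n then ereal q else \<infinity>)" for \<omega> q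
    have "jump_time (\<lambda>t. X t \<omega>) (Suc n) = (INF q\<in>Q. J \<omega> q)" if \<omega>: "\<omega> \<in> space M" for \<omega>
    proof (rule antisym)
      show "jump_time (\<lambda>t. X t \<omega>) (Suc n) \<le> (INF q\<in>Q. J \<omega> q)"
        unfolding jump_time.simps
      proof (rule INF_greatest)
        fix q
        show "Inf {ereal t |t. jump_time (\<lambda>t. X t \<omega>) n < ereal t \<and>
          X t \<omega> \<noteq> X (real_of_ereal (jump_time (\<lambda>t. X t \<omega>) n)) \<omega>} \<le> J \<omega> q"
          by (cases "J \<omega> q = \<infinity>")
            (auto simp: J_def jump_chain_def split: if_splits intro!: Inf_lower)
      qed
      show "(INF q\<in>Q. J \<omega> q) \<le> jump_time (\<lambda>t. X t \<omega>) (Suc n)"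
        unfolding jump_time.simps
      proof (rule Inf_greatest, clarify)
        fix t assume t: "jump_time (\<lambda>t. X t \<omega>) n < ereal t"
          "X t \<omega> \<noteq> X (real_of_ereal (jump_time (\<lambda>t. X t \<omega>) n)) \<omega>"
        then have t0: "0 \<le> t"
          using le_less_trans[OF jump_time_nonneg t(1)] by simp
        obtain u where u: "t < u" "\<And>s. t \<le> s \<Longrightarrow> s < u \<Longrightarrow> X s \<omega> = X t \<omega>"
          using cadlag_path_rightD[OF cadlag[OF \<omega>] t0] by blast
        show "(INF q\<in>Q. J \<omega> q) \<le> ereal t"
        proof (rule ereal_le_epsilon2)
          fix e :: real assume "0 < e"
          \<comment> \<open>By right-continuity, a rational time slightly after \<open>t\<close>
            still sees the value taken at \<open>t\<close>.\<close>
          with u(1) obtain q where q: "q \<in> \<rat>" "t < q" "q < min u (t + e)"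
            using Rats_dense_in_real[of t "min u (t + e)"] by auto
          have "J \<omega> q = ereal q"
            using q t(2) u(2)[of q] less_trans[OF t(1), of "ereal q"]
            by (simp add: J_def jump_chain_def)
          moreover have "q \<in> Q" using q t0 by (auto simp: Q_def)
          ultimately have "(INF q\<in>Q. J \<omega> q) \<le> ereal q" by (metis INF_lower)
          also have "ereal q \<le> ereal t + ereal e" using q(3) by simp
          finally show "(INF q\<in>Q. J \<omega> q) \<le> ereal t + ereal e" .
        qed
      qed
    qed
    moreover have "(\<lambda>\<omega>. INF q\<in>Q. J \<omega> q) \<in> borel_measurable M"
    proof (rule borel_measurable_INF)
      show "countable Q" by (simp add: Q_def countable_rat)
      fix q assume "q \<in> Q"
      then have [measurable]: "X q \<in> measurable M (count_space UNIV)" by (auto simp: Q_def X)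
      show "(\<lambda>\<omega>. J \<omega> q) \<in> borel_measurable M" unfolding J_def by measurable
    qed
    ultimately show ?case by (simp cong: measurable_cong)
  qed simp
  from chain[OF time] show "(\<lambda>\<omega>. jump_chain (\<lambda>t. X t \<omega>) n) \<in> measurable M (count_space UNIV)" .
qed

section \<open>Hitting probabilities\<close>

text \<open>The one-step transition operator of the kernel \<open>p\<close>. Values in
  \<open>ennreal\<close> avoid summability conditions and give direct access to monotone
  convergence.\<close>

definition avg :: "('a \<Rightarrow> 'a \<Rightarrow> ennreal) \<Rightarrow> ('a \<Rightarrow> ennreal) \<Rightarrow> 'a \<Rightarrow> ennreal" where
  "avg p f x = (\<integral>\<^sup>+y. p x y * f y \<partial>count_space UNIV)"

lemma avg_mono: "(\<And>y. f y \<le> g y) \<Longrightarrow> avg p f x \<le> avg p g x"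
  unfolding avg_def by (intro nn_integral_mono mult_left_mono) auto

lemma avg_add: "avg p (\<lambda>y. f y + g y) x = avg p f x + avg p g x"
  by (simp add: avg_def distrib_left nn_integral_add)

lemma avg_SUP:
  assumes "\<And>y. incseq (\<lambda>n. f n y)"
  shows "avg p (\<lambda>y. SUP n. f n y) x = (SUP n. avg p (f n) x)"
  unfolding avg_def SUP_mult_left_ennreal
  by (rule nn_integral_monotone_convergence_SUP)
    (use assms in \<open>auto simp: incseq_def le_fun_def intro!: mult_left_mono\<close>)

text \<open>\<open>hit_within p c F k x\<close> is the probability of hitting \<open>c\<close> from \<open>x\<close> in at most \<open>k\<close> steps,
  without leaving \<open>F\<close> before.\<close>

primrec hit_within :: "('a \<Rightarrow> 'a \<Rightarrow> ennreal) \<Rightarrow> 'a \<Rightarrow> 'a set \<Rightarrow> nat \<Rightarrow> 'a \<Rightarrow> ennreal" where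
  "hit_within p c F 0 x = (if x = c then 1 else 0)"
| "hit_within p c F (Suc k) x =
     (if x = c then 1 else if x \<in> F then avg p (hit_within p c F k) x else 0)"

definition hit :: "('a \<Rightarrow> 'a \<Rightarrow> ennreal) \<Rightarrow> 'a \<Rightarrow> 'a set \<Rightarrow> 'a \<Rightarrow> ennreal" where
  "hit p c F x = (SUP k. hit_within p c F k x)"

lemma hit_within_target [simp]: "hit_within p c F k c = 1"
  by (cases k) auto

lemma hit_within_mono_set: "F \<subseteq> G \<Longrightarrow> hit_within p c F k x \<le> hit_within p c G k x"
  by (induction k arbitrary: x) (auto intro!: avg_mono)

lemma hit_within_Suc: "hit_within p c F k x \<le> hit_within p c F (Suc k) x"
proof (induction k arbitrary: x)
  case (Suc k)
  then have "avg p (hit_within p c F k) x \<le> avg p (hit_within p c F (Suc k)) x"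
    by (rule avg_mono)
  then show ?case by simp
qed simp

lemma incseq_hit_within: "incseq (\<lambda>k. hit_within p c F k x)"
  by (rule incseq_SucI) (rule hit_within_Suc)

lemma hit_target [simp]: "hit p c F c = 1"
  by (simp add: hit_def)

lemma hit_mono_set: "F \<subseteq> G \<Longrightarrow> hit p c F x \<le> hit p c G x"
  unfolding hit_def by (intro SUP_mono' hit_within_mono_set)

lemma hit_outside: "x \<notin> F \<Longrightarrow> x \<noteq> c \<Longrightarrow> hit p c F x = 0"
proof -
  assume "x \<notin> F" "x \<noteq> c"
  then have "hit_within p c F k x = 0" for k by (cases k) auto
  then show ?thesis by (simp add: hit_def)
qed

lemma avg_hit: "avg p (hit p c F) x = (SUP k. avg p (hit_within p c F k) x)"
  unfolding hit_def by (rule avg_SUP) (rule incseq_hit_within)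

text \<open>The first-step recursion of \<open>hit_within\<close> passes to the limit by monotone
  convergence, since shifting the step count by one does not change the supremum.\<close>

lemma hit_eq_avg:
  assumes "x \<in> F" "x \<noteq> c"
  shows "hit p c F x = avg p (hit p c F) x"
proof -
  have "hit p c F x = (SUP k. hit_within p c F (Suc k) x)"
    unfolding hit_def
    by (intro antisym SUP_least)
      (meson SUP_upper2 UNIV_I hit_within_Suc, meson SUP_upper UNIV_I)
  with assms show ?thesis by (simp add: avg_hit)
qed

text \<open>Induction on the number of steps: the sets eventually contain the current state, and
  monotone convergence handles the states after the next step.\<close>

lemma hit_within_exhaustion:
  assumes "incseq F" "(\<Union>n. F n) = UNIV"
  shows "(SUP n. hit_within p c (F n) k x) = hit_within p c UNIV k x"
proof (induction k arbitrary: x)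
  case (Suc k)
  show ?case
  proof (cases "x = c")
    case False
    obtain m where m: "x \<in> F m" using assms(2) by blast
    have inc: "incseq (\<lambda>n. hit_within p c (F n) k y)" for y
      using assms(1) by (intro incseq_SucI hit_within_mono_set) (auto simp: incseq_Suc_iff)
    have "(SUP n. hit_within p c (F n) (Suc k) x) = (SUP n. avg p (hit_within p c (F n) k) x)"
    proof (rule antisym)
      show "(SUP n. hit_within p c (F n) (Suc k) x) \<le> (SUP n. avg p (hit_within p c (F n) k) x)"
        using False by (intro SUP_mono') auto
      show "(SUP n. avg p (hit_within p c (F n) k) x) \<le> (SUP n. hit_within p c (F n) (Suc k) x)"
      proof (rule SUP_least)
        fix n
        \<comment> \<open>Enlarging the index to \<open>max m n\<close> puts \<open>x\<close> into
          the set, so that the averaging clause of \<open>hit_within\<close> applies.\<close>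
        have "x \<in> F (max m n)" using m incseqD[OF assms(1), of m "max m n"] by auto
        moreover have "avg p (hit_within p c (F n) k) x \<le> avg p (hit_within p c (F (max m n)) k) x"
          using assms(1) by (intro avg_mono hit_within_mono_set) (auto simp: incseq_def)
        ultimately have "avg p (hit_within p c (F n) k) x \<le> hit_within p c (F (max m n)) (Suc k) x"
          using False by simp
        then show "avg p (hit_within p c (F n) k) x \<le> (SUP n. hit_within p c (F n) (Suc k) x)"
          by (meson SUP_upper2 UNIV_I)
      qed
    qed
    also have "\<dots> = avg p (\<lambda>y. SUP n. hit_within p c (F n) k y) x"
      by (rule avg_SUP[symmetric]) (rule inc)
    finally show ?thesis using False Suc by simp
  qed simp
qed simp

lemma hit_exhaustion:
  assumes "incseq F" "(\<Union>n. F n) = UNIV"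
  shows "(SUP n. hit p c (F n) x) = hit p c UNIV x"
  unfolding hit_def by (subst SUP_commute) (simp add: hit_within_exhaustion[OF assms])

section \<open>Avoiding a state for a given number of steps\<close>

text \<open>The probability of making \<open>k\<close> more steps, all into \<open>A\<close>. The
  starting state need not lie in \<open>A\<close>: for \<open>A = - {c}\<close> and start
  \<open>c\<close> this is the probability of no return within \<open>k\<close> steps.\<close>

primrec stay :: "('a \<Rightarrow> 'a \<Rightarrow> ennreal) \<Rightarrow> 'a set \<Rightarrow> nat \<Rightarrow> 'a \<Rightarrow> ennreal" where
  "stay p A 0 x = 1"
| "stay p A (Suc k) x = avg p (\<lambda>z. stay p A k z * indicator A z) x"

lemma stay_UNIV:
  assumes "\<And>x. avg p (\<lambda>_. 1) x = 1"
  shows "stay p UNIV k x = 1"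
proof (induction k arbitrary: x)
  case (Suc k)
  with assms show ?case by simp
qed simp

text \<open>The two terms belong to complementary events: the next \<open>Suc k\<close> states
  either all avoid \<open>c\<close> or contain \<open>c\<close>. Averaging accounts for the first of
  these steps, hence the index \<open>k\<close> in the second term.\<close>

lemma stay_add_avg_hit_within:
  assumes "\<And>x. avg p (\<lambda>_. 1) x = 1"
  shows "stay p (- {c}) (Suc k) x + avg p (hit_within p c UNIV k) x = 1"
proof (induction k arbitrary: x)
  case 0
  have "(\<lambda>z. indicator (- {c}) z + hit_within p c UNIV 0 z) = (\<lambda>_. 1)"
    by (auto simp: indicator_def)
  with assms show ?case by (simp add: avg_add[symmetric])
next
  case (Suc k)
  have "stay p (- {c}) (Suc k) z * indicator (- {c}) z + hit_within p c UNIV (Suc k) z = 1" for z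
    using Suc[of z] by (cases "z = c") auto
  then have "avg p (\<lambda>z. stay p (- {c}) (Suc k) z * indicator (- {c}) z +
      hit_within p c UNIV (Suc k) z) x = 1"
    using assms by simp
  then show ?case unfolding avg_add by (simp only: stay.simps)
qed

lemma hit_le_1:
  assumes "\<And>x. avg p (\<lambda>_. 1) x = 1"
  shows "hit p c F x \<le> 1"
proof -
  have "hit_within p c UNIV k x \<le> 1" for k
  proof (cases k)
    case (Suc m)
    then show ?thesis
      using stay_add_avg_hit_within[of p c m x, OF assms]
      by (auto simp del: stay.simps) (metis le_iff_add add.commute)
  qed simp
  then have "hit p c UNIV x \<le> 1" unfolding hit_def by (auto intro: SUP_least)
  then show ?thesis using hit_mono_set[of F UNIV p c x] by auto
qed

text \<open>The limit of the complement identity; it translates between a null event of never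
  returning and a return probability of 1.\<close>

lemma INF_stay_eq_0_iff:
  assumes "\<And>x. avg p (\<lambda>_. 1) x = 1"
  shows "(INF k. stay p (- {c}) k x) = 0 \<longleftrightarrow> avg p (hit p c UNIV) x = 1"
proof -
  define s where "s k = stay p (- {c}) (Suc k) x" for k
  define a where "a k = avg p (hit_within p c UNIV k) x" for k
  have sa: "s k + a k = 1" for k
    using stay_add_avg_hit_within[OF assms] by (simp add: s_def a_def del: stay.simps)
  have fin: "s k \<le> 1" "a k \<le> 1" for k
    using sa[of k] by (metis le_iff_add, metis le_iff_add add.commute)
  have a: "a k = 1 - s k" for k
    using sa[of k] fin(1)[of k]
    by (metis ennreal_add_diff_cancel_left ennreal_one_neq_top top.extremum_uniqueI)
  \<comment> \<open>Dropping the index 0 is harmless because \<open>stay\<close> equals 1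
    there.\<close>
  have "(INF k. stay p (- {c}) k x) = (INF k. s k)"
  proof (rule antisym)
    show "(INF k. stay p (- {c}) k x) \<le> (INF k. s k)"
      unfolding s_def by (meson INF_greatest INF_lower UNIV_I)
    show "(INF k. s k) \<le> (INF k. stay p (- {c}) k x)"
    proof (rule INF_greatest)
      fix k show "(INF k. s k) \<le> stay p (- {c}) k x"
      proof (cases k)
        case 0
        then show ?thesis using fin(1)[of 0] by (auto intro: INF_lower2)
      qed (auto simp: s_def simp del: stay.simps intro: INF_lower)
    qed
  qed
  moreover have "avg p (hit p c UNIV) x = 1 - (INF k. s k)"
    by (simp add: avg_hit a_def[symmetric] a ennreal_INF_const_minus)
  \<comment> \<open>Subtraction in \<open>ennreal\<close> is truncated and cancels only finite
    terms, so the equivalence is read off from a sum equal to 1.\<close>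
  moreover have "(INF k. s k) \<le> 1" using fin(1)[of 0] by (auto intro: INF_lower2)
  then have "(INF k. s k) + (1 - (INF k. s k)) = 1" by (rule add_diff_inverse_ennreal)
  then have "(INF k. s k) = 0" if "1 - (INF k. s k) = 1"
    unfolding that using ennreal_add_left_cancel[of 1 "INF k. s k" 0] by (simp add: add.commute)
  then have "1 - (INF k. s k) = 1 \<longleftrightarrow> (INF k. s k) = 0" by auto
  ultimately show ?thesis by simp
qed

text \<open>If the return probability to \<open>c\<close> is 1, then \<open>hit p c UNIV\<close> is harmonic everywhere and
  attains its maximum 1 at \<open>c\<close>, hence the maximum principle applies.\<close>

lemma hit_eq_1:
  assumes p: "\<And>x. avg p (\<lambda>_. 1) x = 1" and c: "avg p (hit p c UNIV) c = 1"
    and closed: "\<And>C. c \<in> C \<Longrightarrow> (\<And>x y. x \<in> C \<Longrightarrow> p x y \<noteq> 0 \<Longrightarrow> y \<in> C) \<Longrightarrow> C = UNIV"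
  shows "hit p c UNIV x = 1"
proof -
  define h where "h = hit p c UNIV"
  have h1: "h y \<le> 1" for y unfolding h_def by (rule hit_le_1[OF p])
  have harm: "h y = avg p h y" for y
    using c hit_eq_avg[of y UNIV c p] by (cases "y = c") (auto simp: h_def)
  have "{x. h x = 1} = UNIV"
  proof (rule closed)
    fix x y assume x: "x \<in> {x. h x = 1}" and pos: "p x y \<noteq> 0"
    \<comment> \<open>Where \<open>h\<close> equals 1, the defect \<open>1 - h\<close> has average
      0, so it vanishes at every state reachable in one step.\<close>
    have "(\<lambda>z. h z + (1 - h z)) = (\<lambda>_. 1)"
      using h1 by (simp add: add_diff_inverse_ennreal)
    then have "avg p h x + avg p (\<lambda>z. 1 - h z) x = 1"
      using p by (simp add: avg_add[symmetric])
    then have "avg p (\<lambda>z. 1 - h z) x = 0"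
      using x harm[of x] ennreal_add_left_cancel[of 1 "avg p (\<lambda>z. 1 - h z) x" 0] by simp
    then have "p x y * (1 - h y) = 0"
      by (simp add: avg_def nn_integral_0_iff_AE AE_count_space)
    with pos have "1 - h y = 0" by simp
    then show "y \<in> {x. h x = 1}" using h1[of y] by (auto simp: diff_eq_0_iff_ennreal)
  qed (simp add: h_def)
  then show ?thesis by (auto simp: h_def)
qed

section \<open>The sector condition\<close>

text \<open>The kernel of the embedded jump chain. Division by zero makes the row of a state with
  holding rate 0 vanish.\<close>

definition jump_prob :: "('a::countable \<Rightarrow> 'a \<Rightarrow> real) \<Rightarrow> 'a \<Rightarrow> 'a \<Rightarrow> ennreal" where
  "jump_prob r x y = ennreal (r x y / holding_rate r x)"

lemma holding_rate_has_sum: "jump_rates r \<Longrightarrow> (r x has_sum holding_rate r x) UNIV"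
  by (auto simp: jump_rates_def holding_rate_def)

lemma holding_rate_nonneg: "jump_rates r \<Longrightarrow> 0 \<le> holding_rate r x"
  by (auto simp: jump_rates_def holding_rate_def intro!: infsum_nonneg)

text \<open>Stationarity says exactly that the adjoint rates out of \<open>x\<close> also sum to the
  holding rate of \<open>x\<close>; the symmetric rates are the mean of both families.\<close>

lemma symmetric_rate_has_sum:
  assumes "jump_rates r" "stationary_measure r \<mu>"
  shows "(symmetric_rate \<mu> r x has_sum holding_rate r x) UNIV"
proof -
  from assms(2) have \<mu>: "0 < \<mu> x"
    and "((\<lambda>y. \<mu> y * r y x) has_sum (\<mu> x * holding_rate r x)) UNIV"
    by (auto simp: stationary_measure_def)
  then have "((\<lambda>y. inverse (\<mu> x) * (\<mu> y * r y x)) has_sum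
      (inverse (\<mu> x) * (\<mu> x * holding_rate r x))) UNIV"
    by (intro has_sum_cmult_right)
  then have "(adjoint_rate \<mu> r x has_sum holding_rate r x) UNIV"
    using \<mu> by (simp add: adjoint_rate_def[abs_def] field_simps)
  from has_sum_add[OF holding_rate_has_sum[OF assms(1), of x] this]
  have "((\<lambda>y. (1/2) * (r x y + adjoint_rate \<mu> r x y)) has_sum
      ((1/2) * (holding_rate r x + holding_rate r x))) UNIV"
    by (rule has_sum_cmult_right)
  then show ?thesis by (simp add: symmetric_rate_def[abs_def])
qed

text \<open>Equal holding rates give the escape probabilities of both processes the same
  prefactor.\<close>

lemma holding_rate_symmetric:
  assumes "jump_rates r" "stationary_measure r \<mu>"
  shows "holding_rate (symmetric_rate \<mu> r) x = holding_rate r x"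
  using symmetric_rate_has_sum[OF assms] by (auto simp: holding_rate_def intro!: infsumI)

lemma jump_rates_symmetric:
  assumes "jump_rates r" "stationary_measure r \<mu>"
  shows "jump_rates (symmetric_rate \<mu> r)"
proof -
  have "0 < \<mu> x" for x using assms(2) by (auto simp: stationary_measure_def)
  with assms(1) have "0 \<le> symmetric_rate \<mu> r x y" for x y
    by (auto simp: symmetric_rate_def adjoint_rate_def jump_rates_def less_imp_le)
  moreover have "symmetric_rate \<mu> r x x = 0" for x
    using assms(1) by (auto simp: symmetric_rate_def adjoint_rate_def jump_rates_def)
  ultimately show ?thesis
    using symmetric_rate_has_sum[OF assms] unfolding jump_rates_def
    by (blast intro: has_sum_imp_summable)
qed

section \<open>Quadratic forms of finitely supported functions\<close>

lemma generator_finite_support: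
  assumes "jump_rates r" "finite F" "{y. f y \<noteq> 0} \<subseteq> F"
  shows "generator r f x = (\<Sum>y\<in>F. r x y * f y) - holding_rate r x * f x"
proof -
  have "((\<lambda>y. r x y * f y) has_sum (\<Sum>y\<in>F. r x y * f y)) UNIV"
    using assms(2,3) by (intro has_sum_finite_neutralI[of F]) auto
  moreover have "((\<lambda>y. - (r x y * f x)) has_sum - (holding_rate r x * f x)) UNIV"
    by (intro has_sum_uminusI has_sum_cmult_left holding_rate_has_sum assms(1))
  ultimately have "((\<lambda>y. r x y * f y + - (r x y * f x)) has_sum
      ((\<Sum>y\<in>F. r x y * f y) + - (holding_rate r x * f x))) UNIV"
    by (rule has_sum_add)
  then show ?thesis
    unfolding generator_def by (intro infsumI) (simp add: right_diff_distrib)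
qed

lemma inner_L2_finite_support:
  assumes "finite F" "{y. g y \<noteq> 0} \<subseteq> F"
  shows "inner_L2 \<mu> f g = (\<Sum>x\<in>F. \<mu> x * f x * g x)"
  unfolding inner_L2_def
  by (intro infsumI has_sum_finite_neutralI[of F]) (use assms in auto)

text \<open>Only the term at \<open>c\<close> survives. The value does not depend on
  \<open>g\<close>, so the generator of a hitting function may be paired with any test function
  normalised at \<open>c\<close>.\<close>

lemma inner_L2_harmonic:
  assumes "finite F" "c \<in> F" "{y. g y \<noteq> 0} \<subseteq> F" "g c = 1"
    and "\<And>x. x \<in> F \<Longrightarrow> x \<noteq> c \<Longrightarrow> u x = 0"
  shows "inner_L2 \<mu> u g = \<mu> c * u c"
proof -
  have "inner_L2 \<mu> u g = (\<Sum>x\<in>F. \<mu> x * u x * g x)"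
    using assms(1,3) by (rule inner_L2_finite_support)
  also have "\<dots> = (\<Sum>x\<in>{c}. \<mu> x * u x * g x)"
    using assms by (intro sum.mono_neutral_right) auto
  finally show ?thesis using assms(4) by simp
qed

text \<open>The diagonal parts agree because the holding rates do. Exchanging the two summation
  variables identifies the off-diagonal part for the adjoint rates with the one for
  \<open>r\<close>.\<close>

lemma inner_generator_symmetric:
  assumes r: "jump_rates r" and stat: "stationary_measure r \<mu>"
    and F: "finite F" "{y. f y \<noteq> 0} \<subseteq> F"
  shows "inner_L2 \<mu> (\<lambda>x. - generator (symmetric_rate \<mu> r) f x) f =
    inner_L2 \<mu> (\<lambda>x. - generator r f x) f"
proof -
  define Q where "Q \<rho> = (\<Sum>x\<in>F. \<Sum>y\<in>F. \<mu> x * \<rho> x y * f x * f y)" for \<rho> :: "'a \<Rightarrow> 'a \<Rightarrow> real"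
  have form: "inner_L2 \<mu> (\<lambda>x. - generator \<rho> f x) f =
      (\<Sum>x\<in>F. \<mu> x * holding_rate \<rho> x * f x * f x) - Q \<rho>" if "jump_rates \<rho>" for \<rho>
    unfolding inner_L2_finite_support[OF F] Q_def
      generator_finite_support[OF that F]
    by (simp add: sum_subtractf[symmetric] sum_distrib_left sum_distrib_right algebra_simps)
  have "Q (adjoint_rate \<mu> r) = (\<Sum>x\<in>F. \<Sum>y\<in>F. \<mu> y * r y x * f y * f x)"
  proof -
    have "\<mu> x * adjoint_rate \<mu> r x y = \<mu> y * r y x" for x y
      using stat by (intro adjoint_rate_balance[symmetric]) (auto simp: stationary_measure_def)
    then show ?thesis unfolding Q_def by (intro sum.cong) (auto simp: mult_ac)
  qed
  also have "\<dots> = Q r" unfolding Q_def by (rule sum.swap)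
  finally have "Q (adjoint_rate \<mu> r) = Q r" .
  moreover have "Q (symmetric_rate \<mu> r) = (Q r + Q (adjoint_rate \<mu> r)) / 2"
    unfolding Q_def symmetric_rate_def sum.distrib[symmetric] sum_divide_distrib
    by (intro sum.cong) (auto simp: field_simps)
  ultimately show ?thesis
    using form[OF r] form[OF jump_rates_symmetric[OF r stat]]
    by (simp add: holding_rate_symmetric[OF r stat])
qed

lemma avg_jump_prob_one:
  assumes "jump_rates r" "0 < holding_rate r x"
  shows "avg (jump_prob r) (\<lambda>_. 1) x = 1"
proof -
  have "((\<lambda>y. r x y * inverse (holding_rate r x)) has_sum
      (holding_rate r x * inverse (holding_rate r x))) UNIV"
    by (intro has_sum_cmult_left holding_rate_has_sum assms(1))
  then have hs: "((\<lambda>y. r x y / holding_rate r x) has_sum 1) UNIV"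
    using assms(2) by (simp add: divide_inverse)
  have nn: "0 \<le> r x y / holding_rate r x" for y
    using assms by (auto simp: jump_rates_def)
  \<comment> \<open>The passage from \<open>has_sum\<close> to the nonnegative integral over the
    counting measure goes through \<open>infsetsum\<close>.\<close>
  have abs: "Infinite_Set_Sum.abs_summable_on (\<lambda>y. r x y / holding_rate r x) UNIV"
    unfolding abs_summable_equivalent[symmetric]
    using has_sum_imp_summable[OF hs] nn by (simp only: real_norm_def abs_of_nonneg)
  have "avg (jump_prob r) (\<lambda>_. 1) x = ennreal (infsetsum (\<lambda>y. r x y / holding_rate r x) UNIV)"
    unfolding avg_def jump_prob_def using nn nn_integral_conv_infsetsum[OF abs] by simp
  also have "infsetsum (\<lambda>y. r x y / holding_rate r x) UNIV = 1"
    using infsetsum_infsum[OF abs] infsumI[OF hs] by simp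
  finally show ?thesis by simp
qed

text \<open>The generator is the holding rate times (one-step average minus identity). Finite
  support and the bound 1 keep all values finite, so nothing is lost in passing from
  \<open>ennreal\<close> to reals.\<close>

lemma generator_eq_avg:
  assumes "jump_rates r" "0 < holding_rate r x" "finite F"
    and "{y. f y \<noteq> 0} \<subseteq> F" "\<And>y. f y \<le> 1"
  shows "generator r (\<lambda>y. enn2real (f y)) x =
    holding_rate r x * (enn2real (avg (jump_prob r) f x) - enn2real (f x))"
proof -
  have nn: "0 \<le> r x y / holding_rate r x" for y
    using assms(1,2) by (auto simp: jump_rates_def)
  have fin: "f y < \<top>" for y using assms(5)[of y] by (simp add: order.strict_trans1)
  have "avg (jump_prob r) f x = (\<Sum>y\<in>F. ennreal (r x y / holding_rate r x) * f y)"
    unfolding avg_def jump_prob_def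
    using assms(3,4) by (intro nn_integral_count_space') auto
  also have "\<dots> = (\<Sum>y\<in>F. ennreal (r x y / holding_rate r x * enn2real (f y)))"
    using nn fin by (intro sum.cong refl) (simp only: ennreal_mult enn2real_nonneg ennreal_enn2real)
  also have "\<dots> = ennreal (\<Sum>y\<in>F. r x y / holding_rate r x * enn2real (f y))"
    using nn by (intro sum_ennreal mult_nonneg_nonneg) auto
  finally have "enn2real (avg (jump_prob r) f x) =
      (\<Sum>y\<in>F. r x y / holding_rate r x * enn2real (f y))"
    using nn by (simp only: enn2real_ennreal sum_nonneg mult_nonneg_nonneg enn2real_nonneg)
  then have "holding_rate r x * enn2real (avg (jump_prob r) f x) = (\<Sum>y\<in>F. r x y * enn2real (f y))"
    using assms(2) by (simp add: sum_distrib_left)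
  then show ?thesis
    using assms(4) by (subst generator_finite_support[OF assms(1,3)])
      (auto simp: right_diff_distrib)
qed

text \<open>First-step analysis gives harmonicity off \<open>c\<close>; at \<open>c\<close> the
  negated generator is the holding rate times the probability of escaping from \<open>F\<close>
  before returning.\<close>

lemma generator_hit:
  assumes "jump_rates r" "\<And>x. 0 < holding_rate r x" "finite F" "c \<in> F"
    and h: "h = (\<lambda>y. enn2real (hit (jump_prob r) c F y))"
  shows "\<And>x. x \<in> F \<Longrightarrow> x \<noteq> c \<Longrightarrow> generator r h x = 0"
    and "generator r h c =
      holding_rate r c * (enn2real (avg (jump_prob r) (hit (jump_prob r) c F) c) - 1)"
    and "{x. h x \<noteq> 0} \<subseteq> F" and "h c = 1"
proof -
  have out: "{y. hit (jump_prob r) c F y \<noteq> 0} \<subseteq> F"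
    using assms(4) hit_outside[of _ F c "jump_prob r"] by auto
  then show "{x. h x \<noteq> 0} \<subseteq> F" by (auto simp: h)
  show "h c = 1" by (simp add: h)
  have gen: "generator r h x = holding_rate r x *
      (enn2real (avg (jump_prob r) (hit (jump_prob r) c F) x) - h x)" for x
    unfolding h
    by (rule generator_eq_avg[OF assms(1,2,3) out hit_le_1[OF avg_jump_prob_one[OF assms(1,2)]]])
  then show "generator r h c =
      holding_rate r c * (enn2real (avg (jump_prob r) (hit (jump_prob r) c F) c) - 1)"
    using \<open>h c = 1\<close> by simp
  show "generator r h x = 0" if "x \<in> F" "x \<noteq> c" for x
    using gen[of x] hit_eq_avg[OF that, of "jump_prob r"] by (simp add: h)
qed

section \<open>Comparison of escape probabilities\<close>

text \<open>For the escape probabilities \<open>A\<close> and \<open>B\<close> of the two chains,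
  the sector condition becomes \<open>(K * A)\<^sup>2 \<le> C0 * (K * A) * (K * B)\<close>, from
  which \<open>K\<close> and one factor \<open>A\<close> cancel. The absolute value is taken because
  the sign of \<open>C0\<close> is not prescribed.\<close>

lemma sector_escape_le:
  assumes r: "jump_rates r" and pos: "\<And>x. 0 < holding_rate r x"
    and stat: "stationary_measure r \<mu>" and dom: "generator_domain r \<mu> D"
    and sector: "\<And>f g. f \<in> D \<Longrightarrow> g \<in> D \<Longrightarrow> (inner_L2 \<mu> (generator r f) g)\<^sup>2
          \<le> C0 * inner_L2 \<mu> (\<lambda>x. - generator r f x) f * inner_L2 \<mu> (\<lambda>x. - generator r g x) g"
    and F: "finite F" "c \<in> F"
  defines "p \<equiv> jump_prob r" and "q \<equiv> jump_prob (symmetric_rate \<mu> r)"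
  shows "1 - enn2real (avg p (hit p c F) c) \<le> \<bar>C0\<bar> * (1 - enn2real (avg q (hit q c F) c))"
proof -
  let ?s = "symmetric_rate \<mu> r"
  have s: "jump_rates ?s" using r stat by (rule jump_rates_symmetric)
  have hs: "holding_rate ?s x = holding_rate r x" for x using r stat by (rule holding_rate_symmetric)
  have pos': "0 < holding_rate ?s x" for x using pos hs by simp
  define h where "h = (\<lambda>y. enn2real (hit p c F y))"
  define g where "g = (\<lambda>y. enn2real (hit q c F y))"
  define A where "A = 1 - enn2real (avg p (hit p c F) c)"
  define B where "B = 1 - enn2real (avg q (hit q c F) c)"
  define K where "K = \<mu> c * holding_rate r c"
  have K: "0 < K" using pos stat by (simp add: K_def stationary_measure_def)
  note H = generator_hit[OF r pos F h_def[unfolded p_def], folded p_def]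
  note G = generator_hit[OF s pos' F g_def[unfolded q_def], folded q_def]
  have "B \<ge> 0"
  proof -
    have one: "avg q (\<lambda>_. 1) x = 1" for x unfolding q_def by (rule avg_jump_prob_one[OF s pos'])
    have "avg q (hit q c F) c \<le> avg q (\<lambda>_. 1) c"
      by (intro avg_mono hit_le_1 one)
    then have "enn2real (avg q (hit q c F) c) \<le> 1" unfolding one by (simp add: enn2real_leI)
    then show ?thesis by (simp add: B_def)
  qed
  have "finite {x. h x \<noteq> 0}" "finite {x. g x \<noteq> 0}"
    using finite_subset[OF H(3)] finite_subset[OF G(3)] F(1) by auto
  then have "h \<in> D" "g \<in> D" using dom by (auto simp: generator_domain_def)
  then have "(inner_L2 \<mu> (generator r h) g)\<^sup>2
      \<le> C0 * inner_L2 \<mu> (\<lambda>x. - generator r h x) h * inner_L2 \<mu> (\<lambda>x. - generator r g x) g"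
    by (rule sector)
  moreover have "inner_L2 \<mu> (generator r h) g = - K * A"
    using inner_L2_harmonic[OF F G(3,4), of "generator r h" \<mu>] H(1,2)
    by (simp add: K_def A_def algebra_simps)
  moreover have "inner_L2 \<mu> (\<lambda>x. - generator r h x) h = K * A"
    using inner_L2_harmonic[OF F H(3,4), of "\<lambda>x. - generator r h x" \<mu>] H(1,2)
    by (simp add: K_def A_def algebra_simps)
  \<comment> \<open>Here \<open>g\<close> is harmonic for the symmetric rates and not for
    \<open>r\<close>; the quadratic form is first rewritten with the symmetric generator.\<close>
  moreover have "inner_L2 \<mu> (\<lambda>x. - generator r g x) g = K * B"
    using inner_L2_harmonic[OF F G(3,4), of "\<lambda>x. - generator ?s g x" \<mu>] G(1,2)
      inner_generator_symmetric[OF r stat F(1) G(3)]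
    by (simp add: K_def B_def hs algebra_simps)
  ultimately have "(- K * A)\<^sup>2 \<le> C0 * (K * A) * (K * B)" by simp
  then have "K\<^sup>2 * (A * A) \<le> K\<^sup>2 * (C0 * A * B)" by (simp add: power2_eq_square algebra_simps)
  then have AB: "A * A \<le> C0 * A * B" using K by simp
  have "A \<le> \<bar>C0\<bar> * B"
  \<comment> \<open>Cancelling \<open>A\<close> requires it to be positive; otherwise the
    nonnegative right-hand side suffices.\<close>
  proof (cases "A > 0")
    case True
    with AB have "A \<le> C0 * B" by (simp add: mult_ac)
    also have "\<dots> \<le> \<bar>C0\<bar> * B" using \<open>B \<ge> 0\<close> by (intro mult_right_mono) auto
    finally show ?thesis .
  next
    case False
    moreover have "0 \<le> \<bar>C0\<bar> * B" using \<open>B \<ge> 0\<close> by simp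
    ultimately show ?thesis by linarith
  qed
  then show ?thesis by (simp add: A_def B_def)
qed

lemma sector_return_prob:
  assumes r: "jump_rates r" and pos: "\<And>x. 0 < holding_rate r x"
    and stat: "stationary_measure r \<mu>" and dom: "generator_domain r \<mu> D"
    and sector: "sector_condition r \<mu> D"
  defines "p \<equiv> jump_prob r" and "q \<equiv> jump_prob (symmetric_rate \<mu> r)"
  assumes rec: "avg q (hit q c UNIV) c = 1"
  shows "avg p (hit p c UNIV) c = 1"
proof -
  \<comment> \<open>Finite sets exhausting the state space along its enumeration, with
    \<open>c\<close> inserted so that every one of them contains it.\<close>
  define F where "F n = insert c {x. to_nat x < n}" for n
  have F: "finite (F n)" "c \<in> F n" for n
    using finite_vimageI[OF finite_lessThan[of n] inj_to_nat]
    by (auto simp: F_def vimage_def)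
  have inc: "incseq F" by (auto simp: F_def incseq_def)
  have un: "(\<Union>n. F n) = UNIV" by (auto simp: F_def)
  have lim: "(\<lambda>n. avg k (hit k c (F n)) c) \<longlonglongrightarrow> avg k (hit k c UNIV) c" for k
  proof -
    have "incseq (\<lambda>n. avg k (hit k c (F n)) c)"
      using inc by (intro incseq_SucI avg_mono hit_mono_set) (auto simp: incseq_Suc_iff)
    then have "(\<lambda>n. avg k (hit k c (F n)) c) \<longlonglongrightarrow> (SUP n. avg k (hit k c (F n)) c)"
      by (rule LIMSEQ_SUP)
    also have "(SUP n. avg k (hit k c (F n)) c) = avg k (\<lambda>y. SUP n. hit k c (F n) y) c"
      using inc by (intro avg_SUP[symmetric] incseq_SucI hit_mono_set) (auto simp: incseq_Suc_iff)
    finally show ?thesis by (simp add: hit_exhaustion[OF inc un])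
  qed
  obtain C0 where C0: "\<And>f g. f \<in> D \<Longrightarrow> g \<in> D \<Longrightarrow> (inner_L2 \<mu> (generator r f) g)\<^sup>2
          \<le> C0 * inner_L2 \<mu> (\<lambda>x. - generator r f x) f * inner_L2 \<mu> (\<lambda>x. - generator r g x) g"
    using sector by (auto simp: sector_condition_def)
  define a where "a n = enn2real (avg p (hit p c (F n)) c)" for n
  define b where "b n = enn2real (avg q (hit q c (F n)) c)" for n
  have le: "1 - a n \<le> \<bar>C0\<bar> * (1 - b n)" for n
    unfolding a_def b_def p_def q_def by (rule sector_escape_le[OF r pos stat dom C0 F])
  have one: "avg p (\<lambda>_. 1) x = 1" for x unfolding p_def by (rule avg_jump_prob_one[OF r pos])
  have le1: "avg p (hit p c G) c \<le> 1" for G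
    using avg_mono[of "hit p c G" "\<lambda>_. 1" p c] hit_le_1[OF one] one by simp
  have "(\<lambda>n. avg q (hit q c (F n)) c) \<longlonglongrightarrow> ennreal 1" using lim[of q] rec by simp
  then have "b \<longlonglongrightarrow> 1" unfolding b_def by (rule tendsto_enn2real) simp
  \<comment> \<open>The lower bound for \<open>a n\<close> supplied by the escape estimate tends to
    1, and so forces the limit of \<open>a\<close> to be at least 1.\<close>
  then have lim_b: "(\<lambda>n. 1 - \<bar>C0\<bar> * (1 - b n)) \<longlonglongrightarrow> 1 - \<bar>C0\<bar> * (1 - 1)" by (intro tendsto_intros)
  have fin: "avg p (hit p c UNIV) c < \<top>"
    using le_less_trans[OF le1[of UNIV], of \<top>] by simp
  then have lim_a: "a \<longlonglongrightarrow> enn2real (avg p (hit p c UNIV) c)"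
    unfolding a_def using lim[of p] by (intro tendsto_enn2real) auto
  have "1 - \<bar>C0\<bar> * (1 - 1) \<le> enn2real (avg p (hit p c UNIV) c)"
    by (rule LIMSEQ_le[OF lim_b lim_a]) (use le in \<open>auto simp: diff_le_eq add.commute\<close>)
  then have "ennreal 1 \<le> ennreal (enn2real (avg p (hit p c UNIV) c))"
    by (intro ennreal_leI) simp
  also have "\<dots> = avg p (hit p c UNIV) c" using fin by simp
  finally show ?thesis using le1 by (intro antisym) simp_all
qed

section \<open>Recurrence and the jump chain\<close>

text \<open>The exact prefix matches the path probabilities of the process, while the part
  constrained only by \<open>A\<close> is summed out inductively. Finiteness of the last jump time
  makes all states involved meaningful.\<close>

definition cylinder :: "'w measure \<Rightarrow> (real \<Rightarrow> 'w \<Rightarrow> 'a) \<Rightarrow> 'a set \<Rightarrow> nat \<Rightarrow> nat \<Rightarrow> (nat \<Rightarrow> 'a) \<Rightarrow> 'w set" where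
  "cylinder M X A n k y = {\<omega> \<in> space M. jump_time (\<lambda>t. X t \<omega>) (n + k) < \<infinity> \<and>
     (\<forall>i\<le>n. jump_chain (\<lambda>t. X t \<omega>) i = y i) \<and>
     (\<forall>i. n < i \<and> i \<le> n + k \<longrightarrow> jump_chain (\<lambda>t. X t \<omega>) i \<in> A)}"

locale jump_process =
  fixes r :: "'a::countable \<Rightarrow> 'a \<Rightarrow> real" and P :: "'a \<Rightarrow> 'w measure" and X :: "real \<Rightarrow> 'w \<Rightarrow> 'a"
  assumes rates: "jump_rates r" and process: "markov_jump_process r P X"
begin

abbreviation T :: "nat \<Rightarrow> 'w \<Rightarrow> ereal" where "T n \<omega> \<equiv> jump_time (\<lambda>t. X t \<omega>) n"
abbreviation Y :: "nat \<Rightarrow> 'w \<Rightarrow> 'a" where "Y n \<omega> \<equiv> jump_chain (\<lambda>t. X t \<omega>) n"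

lemma prob_space: "prob_space (P x)"
  using process by (simp add: markov_jump_process_def)

lemma measurable_X: "0 \<le> t \<Longrightarrow> X t \<in> measurable (P x) (count_space UNIV)"
  using process by (simp add: markov_jump_process_def)

lemma cadlag: "\<omega> \<in> space (P x) \<Longrightarrow> cadlag_path (\<lambda>t. X t \<omega>)"
  using process by (simp add: markov_jump_process_def)

lemma start: "\<omega> \<in> space (P x) \<Longrightarrow> Y 0 \<omega> = x"
  using process by (simp add: markov_jump_process_def jump_chain_def)

lemma measurable_T [measurable]: "(\<lambda>\<omega>. T n \<omega>) \<in> borel_measurable (P x)"
  and measurable_Y [measurable]: "(\<lambda>\<omega>. Y n \<omega>) \<in> measurable (P x) (count_space UNIV)"
  by (rule measurable_jump[OF measurable_X cadlag]; assumption)+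

lemma sets_cylinder [measurable]: "cylinder (P x) X A n k y \<in> sets (P x)"
  unfolding cylinder_def by measurable

text \<open>The law of the process is used with all time thresholds 0: the exponential factors
  become 1, and the holding times are positive anyway since jump times increase strictly.\<close>

lemma emeasure_path:
  assumes "y 0 = x"
  shows "emeasure (P x) (cylinder (P x) X A n 0 y) = (\<Prod>i<n. jump_prob r (y i) (y (Suc i)))"
proof -
  interpret prob_space "P x" by (rule prob_space)
  have "cylinder (P x) X A n 0 y = {\<omega> \<in> space (P x). T n \<omega> < \<infinity> \<and> (\<forall>i\<le>n. Y i \<omega> = y i) \<and>
      (\<forall>i<n. ereal 0 < holding_time (\<lambda>t. X t \<omega>) i)}"
  proof -
    have "ereal 0 < holding_time (\<lambda>t. X t \<omega>) i"
      if "\<omega> \<in> space (P x)" "T n \<omega> < \<infinity>" "i < n" for \<omega> i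
    proof -
      have "T (Suc i) \<omega> < \<infinity>"
        by (rule jump_time_finite_mono[OF _ that(2)]) (use that(3) in simp)
      moreover have "T i \<omega> < \<infinity>"
        by (rule jump_time_finite_mono[OF _ that(2)]) (use that(3) in simp)
      moreover have "T i \<omega> < T (Suc i) \<omega>"
        using jump_time_less_Suc[OF cadlag[OF that(1)] calculation(2)] .
      ultimately show ?thesis
        using jump_time_nonneg[of "\<lambda>t. X t \<omega>" i]
        by (cases "T i \<omega>"; cases "T (Suc i) \<omega>") (auto simp: holding_time_def simp del: jump_time.simps)
    qed
    then show ?thesis by (auto simp: cylinder_def)
  qed
  then have "measure (P x) (cylinder (P x) X A n 0 y) =
      (\<Prod>i<n. r (y i) (y (Suc i)) / holding_rate r (y i) * exp (- holding_rate r (y i) * 0))"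
    using process[unfolded markov_jump_process_def, THEN spec, of x, THEN conjunct2, THEN conjunct2,
        THEN conjunct2, THEN spec, of n, THEN spec, of y, THEN spec, of "\<lambda>_. 0"] assms
    by (simp add: cylinder_def)
  moreover have "0 \<le> r u v / holding_rate r u" for u v
    using rates holding_rate_nonneg[OF rates] by (auto simp: jump_rates_def)
  ultimately show ?thesis
    by (simp add: emeasure_eq_measure jump_prob_def prod_ennreal)
qed

text \<open>Induction on \<open>k\<close> for all prefixes: splitting by the value of the next state
  turns one constrained step into a prescribed one.\<close>

lemma emeasure_cylinder:
  assumes "y 0 = x"
  shows "emeasure (P x) (cylinder (P x) X A n k y) =
    (\<Prod>i<n. jump_prob r (y i) (y (Suc i))) * stay (jump_prob r) A k (y n)"
  using assms
proof (induction k arbitrary: n y)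
  case 0
  then show ?case by (simp add: emeasure_path)
next
  case (Suc k)
  define y' where "y' z = y(Suc n := z)" for z
  \<comment> \<open>States outside \<open>A\<close> contribute the empty set, so the disjoint union
    may run over the whole type.\<close>
  define E where "E z = (if z \<in> A then cylinder (P x) X A (Suc n) k (y' z) else {})" for z
  have "cylinder (P x) X A n (Suc k) y = (\<Union>z. E z)"
  proof (rule set_eqI)
    fix \<omega>
    have *: "(\<forall>i. n < i \<and> i \<le> Suc (n + k) \<longrightarrow> Y i \<omega> \<in> A) \<longleftrightarrow>
      Y (Suc n) \<omega> \<in> A \<and> (\<forall>i. Suc n < i \<and> i \<le> Suc (n + k) \<longrightarrow> Y i \<omega> \<in> A)"
    proof -
      have "n < i \<and> i \<le> Suc (n + k) \<longleftrightarrow> i = Suc n \<or> Suc n < i \<and> i \<le> Suc (n + k)" for i by auto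
      then show ?thesis by (simp only:) blast
    qed
    have **: "(\<forall>i\<le>Suc n. Y i \<omega> = y' z i) \<longleftrightarrow> (\<forall>i\<le>n. Y i \<omega> = y i) \<and> Y (Suc n) \<omega> = z" for z
      by (auto simp: y'_def le_Suc_eq)
    show "\<omega> \<in> cylinder (P x) X A n (Suc k) y \<longleftrightarrow> \<omega> \<in> (\<Union>z. E z)"
      unfolding E_def by (auto simp: cylinder_def * ** simp del: jump_time.simps split: if_splits)
  qed
  moreover have "emeasure (P x) (\<Union>z. E z) = (\<integral>\<^sup>+z. emeasure (P x) (E z) \<partial>count_space UNIV)"
  proof (rule emeasure_UN_countable)
    show "disjoint_family_on E UNIV"
      by (auto simp: disjoint_family_on_def E_def cylinder_def y'_def split: if_splits)
  qed (auto simp: E_def)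
  moreover have "emeasure (P x) (E z) = (\<Prod>i<n. jump_prob r (y i) (y (Suc i))) *
      (jump_prob r (y n) z * (stay (jump_prob r) A k z * indicator A z))" for z
  proof -
    have "(\<Prod>i<n. jump_prob r (y' z i) (y' z (Suc i))) = (\<Prod>i<n. jump_prob r (y i) (y (Suc i)))"
      by (intro prod.cong) (auto simp: y'_def)
    moreover have "y' z 0 = x" using Suc.prems by (simp add: y'_def)
    ultimately show ?thesis
      using Suc.IH[of "y' z" "Suc n"] by (simp add: E_def mult_ac) (simp add: y'_def mult_ac)
  qed
  ultimately show ?case by (simp add: nn_integral_cmult avg_def)
qed

text \<open>The state at a fixed time is a jump chain state. Any finite path from inside a closed
  set to the outside contains a step of probability 0, and there are only countably many finite
  paths.\<close>

lemma irreducible_closed_eq_UNIV: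
  assumes irred: "irreducible_process P X"
    and "x \<in> C" and closed: "\<And>u v. u \<in> C \<Longrightarrow> jump_prob r u v \<noteq> 0 \<Longrightarrow> v \<in> C"
  shows "C = UNIV"
proof -
  have "z \<in> C" for z
  proof (rule ccontr)
    assume z: "z \<notin> C"
    interpret prob_space "P x" by (rule prob_space)
    obtain t where t: "0 \<le> t" "0 < prob {\<omega> \<in> space (P x). X t \<omega> = z}"
      using irred by (auto simp: irreducible_process_def)
    \<comment> \<open>Paths are encoded as lists because these form a countable type, unlike
      functions on \<open>nat\<close>.\<close>
    define G where "G n ys = (if ys ! 0 = x \<and> ys ! n = z then cylinder (P x) X UNIV n 0 (\<lambda>i. ys ! i) else {})"
      for n and ys :: "'a list"
    have null: "G n ys \<in> null_sets (P x)" for n ys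
    proof (cases "ys ! 0 = x \<and> ys ! n = z")
      case True
      have "\<exists>i<n. jump_prob r (ys ! i) (ys ! Suc i) = 0"
      proof (rule ccontr)
        assume *: "\<not> ?thesis"
        have "i \<le> n \<Longrightarrow> ys ! i \<in> C" for i
        proof (induction i)
          case (Suc i)
          with * closed[of "ys ! i" "ys ! Suc i"] show ?case by auto
        qed (use True \<open>x \<in> C\<close> in simp)
        with True z show False by auto
      qed
      then have "(\<Prod>i<n. jump_prob r (ys ! i) (ys ! Suc i)) = 0" by auto
      with True show ?thesis
        using emeasure_path[of "\<lambda>i. ys ! i" x UNIV n] by (auto simp: G_def null_sets_def)
    qed (auto simp: G_def)
    have "{\<omega> \<in> space (P x). X t \<omega> = z} \<subseteq> (\<Union>n. \<Union>ys. G n ys)"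
    proof clarify
      fix \<omega> assume \<omega>: "\<omega> \<in> space (P x)" "z = X t \<omega>"
      obtain n where n: "T n \<omega> \<le> ereal t" "X t \<omega> = Y n \<omega>"
        using path_in_jump_chain[OF cadlag[OF \<omega>(1)] t(1)] by blast
      define ys where "ys = map (\<lambda>i. Y i \<omega>) [0..<Suc n]"
      have ys: "ys ! i = Y i \<omega>" if "i \<le> n" for i
        using that unfolding ys_def by (subst nth_map) (auto simp del: upt_Suc)
      have "T n \<omega> < \<infinity>" using le_less_trans[OF n(1), of \<infinity>] by simp
      then have "\<omega> \<in> G n ys"
        using \<omega> n start[OF \<omega>(1)] by (simp add: G_def ys cylinder_def)
      then show "\<omega> \<in> (\<Union>n. \<Union>ys. G n ys)" by blast
    qed
    moreover have "(\<Union>n. \<Union>ys. G n ys) \<in> null_sets (P x)"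
      using null by (intro null_sets_UN')  auto
    moreover have "{\<omega> \<in> space (P x). X t \<omega> = z} \<in> sets (P x)"
      using measurable_X[OF t(1)] by measurable
    ultimately have "{\<omega> \<in> space (P x). X t \<omega> = z} \<in> null_sets (P x)"
      by (blast intro: null_sets_subset)
    then show False using t(2) by (simp add: measure_eq_0_null_sets)
  qed
  then show ?thesis by blast
qed

section \<open>Recurrence in time and return of the jump chain\<close>

text \<open>If the chain keeps jumping and never returns to \<open>c\<close>, the visits to
  \<open>c\<close> are bounded in time. Recurrence makes this event null, and continuity from above
  expresses its measure by \<open>stay\<close>.\<close>

lemma recurrent_imp_return:
  assumes pos: "\<And>x. 0 < holding_rate r x" and rec: "recurrent_process P X"
  shows "avg (jump_prob r) (hit (jump_prob r) c UNIV) c = 1"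
proof -
  interpret prob_space "P c" by (rule prob_space)
  define N where "N k = cylinder (P c) X (- {c}) 0 k (\<lambda>_. c)" for k
  have N: "emeasure (P c) (N k) = stay (jump_prob r) (- {c}) k c" for k
    using emeasure_cylinder[of "\<lambda>_. c" c "- {c}" 0 k] by (simp add: N_def)
  have "emeasure (P c) (\<Inter>k. N k) = (INF k. emeasure (P c) (N k))"
  proof (rule INF_emeasure_decseq[symmetric])
    show "decseq N"
    proof (rule decseq_SucI)
      fix k
      have "T k \<omega> < \<infinity>" if "T (Suc k) \<omega> < \<infinity>" for \<omega>
        using that by (rule jump_time_finite_mono[rotated]) simp
      then show "N (Suc k) \<subseteq> N k" by (auto simp: N_def cylinder_def simp del: jump_time.simps)
    qed
  qed (auto simp: N_def)
  moreover have "AE \<omega> in P c. \<omega> \<notin> (\<Inter>k. N k)"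
    using rec[unfolded recurrent_process_def, THEN spec, of c]
  proof eventually_elim
    case (elim \<omega>)
    show ?case
    proof
      assume *: "\<omega> \<in> (\<Inter>k. N k)"
      then have "\<omega> \<in> space (P c)" and fin: "T k \<omega> < \<infinity>"
        and ne: "\<And>i. 0 < i \<Longrightarrow> i \<le> k \<Longrightarrow> Y i \<omega> \<noteq> c" for k
        by (auto simp: N_def cylinder_def simp del: jump_time.simps)
      then have "cadlag_path (\<lambda>t. X t \<omega>)" by (intro cadlag)
      from transient_pathI[OF this fin, of c] ne[OF _ order_refl] elim show False by simp
    qed
  qed
  then have "emeasure (P c) (\<Inter>k. N k) = 0"
    using AE_iff_null_sets[of "\<Inter>k. N k" "P c"] by (auto simp: N_def)
  ultimately have "(INF k. stay (jump_prob r) (- {c}) k c) = 0" by (simp add: N)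
  then show ?thesis by (simp add: INF_stay_eq_0_iff[OF avg_jump_prob_one[OF rates pos]])
qed

text \<open>For \<open>A = UNIV\<close> and an empty prescribed path beyond the start, the cylinder
  only demands a finite \<open>n\<close>-th jump time, and \<open>stay\<close> has value 1.\<close>

lemma AE_jump_time_finite:
  assumes pos: "\<And>x. 0 < holding_rate r x"
  shows "AE \<omega> in P x. \<forall>n. T n \<omega> < \<infinity>"
proof -
  interpret prob_space "P x" by (rule prob_space)
  have "AE \<omega> in P x. T n \<omega> < \<infinity>" for n
  proof -
    have "emeasure (P x) (cylinder (P x) X UNIV 0 n (\<lambda>_. x)) = 1"
      using emeasure_cylinder[of "\<lambda>_. x" x UNIV 0 n]
        stay_UNIV[OF avg_jump_prob_one[OF rates pos]] by simp
    then have "AE \<omega> in P x. \<omega> \<in> cylinder (P x) X UNIV 0 n (\<lambda>_. x)"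
      by (intro AE_in_set_eq_1[THEN iffD2]) (auto simp: emeasure_eq_measure)
    then show ?thesis by eventually_elim (auto simp: cylinder_def)
  qed
  then show ?thesis by (simp add: AE_all_countable)
qed

text \<open>A last visit to \<open>c\<close> in the chain would leave some finite prefix followed by
  eternal avoidance of \<open>c\<close>. Each such event is null whatever state the prefix ends in,
  and there are countably many prefixes.\<close>

lemma recurrentI:
  assumes pos: "\<And>x. 0 < holding_rate r x"
    and hit: "\<And>c x. hit (jump_prob r) c UNIV x = 1"
  shows "recurrent_process P X"
  unfolding recurrent_process_def
proof
  fix c
  interpret prob_space "P c" by (rule prob_space)
  note one = avg_jump_prob_one[OF rates pos]
  have stay: "(INF k. stay (jump_prob r) (- {c}) k x) = 0" for x
  proof -
    have "hit (jump_prob r) c UNIV = (\<lambda>_. 1)" using hit by auto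
    then show ?thesis by (simp add: INF_stay_eq_0_iff[OF one] one)
  qed
  \<comment> \<open>The list starts with \<open>c\<close> to match the start under
    \<open>P c\<close>. If \<open>ys\<close> is too short, the missing entries have some unspecified
    value, and the bound below holds for it as well.\<close>
  define G where "G n ys k = cylinder (P c) X (- {c}) n k (\<lambda>i. (c # ys) ! i)" for n ys k
  have "AE \<omega> in P c. \<omega> \<notin> (\<Inter>k. G n ys k)" for n ys
  proof -
    define Q where "Q = (\<Prod>i<n. jump_prob r ((c # ys) ! i) ((c # ys) ! Suc i))"
    have "Q = emeasure (P c) (cylinder (P c) X UNIV n 0 (\<lambda>i. (c # ys) ! i))"
      unfolding Q_def by (rule emeasure_path[symmetric]) simp
    then have "Q \<le> 1" using emeasure_le_1 by simp
    have "emeasure (P c) (\<Inter>k. G n ys k) \<le> stay (jump_prob r) (- {c}) k ((c # ys) ! n)" for k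
    proof -
      have "emeasure (P c) (\<Inter>k. G n ys k) \<le> emeasure (P c) (G n ys k)"
        by (rule emeasure_mono) (auto simp: G_def)
      also have "\<dots> = Q * stay (jump_prob r) (- {c}) k ((c # ys) ! n)"
        unfolding G_def Q_def by (rule emeasure_cylinder) simp
      also have "\<dots> \<le> 1 * stay (jump_prob r) (- {c}) k ((c # ys) ! n)"
        using \<open>Q \<le> 1\<close> by (intro mult_right_mono) auto
      finally show ?thesis by simp
    qed
    then have "emeasure (P c) (\<Inter>k. G n ys k) \<le> (INF k. stay (jump_prob r) (- {c}) k ((c # ys) ! n))"
      by (rule INF_greatest)
    also have "\<dots> = 0" by (rule stay)
    finally have "(\<Inter>k. G n ys k) \<in> null_sets (P c)" by (auto simp: G_def null_sets_def)
    then show ?thesis by (rule AE_not_in)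
  qed
  then have "AE \<omega> in P c. \<forall>n ys. \<omega> \<notin> (\<Inter>k. G n ys k)" by (simp add: AE_all_countable)
  then show "AE \<omega> in P c. \<not> bdd_above {t. 0 \<le> t \<and> X t \<omega> = c}"
    using AE_jump_time_finite[OF pos, of c] AE_space
  proof eventually_elim
    case (elim \<omega>)
    show ?case
    proof (rule recurrent_pathI)
      show "cadlag_path (\<lambda>t. X t \<omega>)" using elim(3) by (rule cadlag)
      show "T n \<omega> < \<infinity>" for n using elim(2) by blast
      show "\<exists>i>n. Y i \<omega> = c" for n
      proof (rule ccontr)
        assume *: "\<not> ?thesis"
        define ys where "ys = map (\<lambda>i. Y (Suc i) \<omega>) [0..<n]"
        have "(c # ys) ! i = Y i \<omega>" if "i \<le> n" for i
          using that start[OF elim(3)] by (cases i) (auto simp: ys_def)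
        with * elim(2,3) have "\<omega> \<in> (\<Inter>k. G n ys k)"
          by (auto simp: G_def cylinder_def)
        with elim(1) show False by blast
      qed
    qed
  qed
qed

end

theorem lemma5p2:
  fixes r :: "'a::countable \<Rightarrow> 'a \<Rightarrow> real"
    and \<mu> :: "'a \<Rightarrow> real"
    and D :: "('a \<Rightarrow> real) set"
    and P :: "'a \<Rightarrow> 'w measure" and X :: "real \<Rightarrow> 'w \<Rightarrow> 'a"
    and Ps :: "'a \<Rightarrow> 'v measure" and Xs :: "real \<Rightarrow> 'v \<Rightarrow> 'a"
  assumes "jump_rates r"
    and "markov_jump_process r P X"
    and "irreducible_process P X"
    and "stationary_measure r \<mu>"
    and "generator_domain r \<mu> D"
    and "sector_condition r \<mu> D"
    and "markov_jump_process (symmetric_rate \<mu> r) Ps Xs"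
    and "recurrent_process Ps Xs"
  shows "recurrent_process P X"
proof -
  interpret X: jump_process r P X using assms(1,2) by unfold_locales
  interpret Xs: jump_process "symmetric_rate \<mu> r" Ps Xs
    using jump_rates_symmetric[OF assms(1,4)] assms(7) by unfold_locales
  show ?thesis
  \<comment> \<open>With positive holding rates the jump probabilities sum to 1; a state with rate 0
    is absorbing, and irreducibility then leaves a single state.\<close>
  proof (cases "\<forall>x. 0 < holding_rate r x")
    case True
    then have pos: "\<And>x. 0 < holding_rate r x" by blast
    have "avg (jump_prob (symmetric_rate \<mu> r)) (hit (jump_prob (symmetric_rate \<mu> r)) c UNIV) c = 1" for c
      using pos assms(8)
      by (intro Xs.recurrent_imp_return) (simp_all add: holding_rate_symmetric[OF assms(1,4)])
    then have "avg (jump_prob r) (hit (jump_prob r) c UNIV) c = 1" for c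
      by (rule sector_return_prob[OF assms(1) pos assms(4,5,6)])
    \<comment> \<open>Irreducibility excludes proper nonempty closed sets, which turns certain
      return to \<open>c\<close> into certain hitting of \<open>c\<close> from every state.\<close>
    then have "hit (jump_prob r) c UNIV x = 1" for c x
      using X.irreducible_closed_eq_UNIV[OF assms(3)]
      by (intro hit_eq_1 avg_jump_prob_one[OF assms(1) pos]) blast+
    then show ?thesis by (rule X.recurrentI[OF pos])
  next
    case False
    then obtain x where x: "holding_rate r x = 0"
      using holding_rate_nonneg[OF assms(1)] by (metis less_eq_real_def)
    \<comment> \<open>The zero row of \<open>jump_prob\<close> at \<open>x\<close> makes
      \<open>{x}\<close> closed.\<close>
    have "{x} = UNIV"
      by (rule X.irreducible_closed_eq_UNIV[OF assms(3)]) (auto simp: jump_prob_def x)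
    then have "X t \<omega> = y" for t \<omega> y by (metis UNIV_I singletonD)
    moreover have "\<not> bdd_above {0::real..}"
    proof
      assume "bdd_above {0::real..}"
      then obtain b where b: "\<forall>t\<ge>0::real. t \<le> b" by (auto simp: bdd_above_def)
      from b[rule_format, of 0] b[rule_format, of "b + 1"] show False by simp
    qed
    ultimately show ?thesis
      by (auto simp: recurrent_process_def atLeast_def)
  qed
qed

end
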